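(* Let $(S_t,V_t)$ be a sub-Gaussian process in $\mathbb{R}^d$, i.e. a sub-$\psi_N$ process with $\psi_N(\lambda)=\lambda^2/2$ and $\lambda_{\max}=\infty$. Let $U_0$ be a fixed positive definite $d\times d$ matrix and let $\delta\in(0,1)$. Then, with probability at least $1-\delta$, for any stopping time $\tau$, $$\|S_\tau\|^2_{(V_\tau+U_0)^{-1}}\le\log\left(\frac{\det(V_\tau+U_0)}{\det U_0}\right)+2\log(1/\delta).$$
   Context: Fix a filtered probability space $(\Omega,\mathcal{F}=(\mathcal{F}_t)_{t\ge0},P)$ in discrete time ($t\in\{0,1,2,\dots\}$); $\langle\cdot,\cdot\rangle$ is the dot product on $\mathbb{R}^d$, $\mathbb{S}^{d-1}$ the unit sphere, and $\|v\|_A^2=\langle v,Av\rangle$ for a positive semidefinite matrix $A$. Sub-$\psi$ process, for $\psi:[0,\lambda_{\max})\to\mathbb{R}_{\ge0}$: let $(S_t)$ be an $\mathbb{R}^d$-valued process and $(V_t)$ an $\mathbb{R}^{d\times d}$-valued process with $V_t\succ0$, both adapted to $\mathcal{F}$. $(S_t,V_t)$ is a sub-$\psi$ process if for all $\theta\in\mathbb{S}^{d-1}$, all $\lambda\in[0,\lambda_{\max})$ and all $t\ge0$, $$\exp\{\lambda\langle\theta,S_t\rangle-\psi(\lambda)\langle\theta,V_t\theta\rangle\}\le L_t^\lambda(\theta),$$ where $(L_t^\lambda(\theta))_{t\ge0}$ is a nonnegative supermartingale adapted to $\mathcal{F}$ with $L_0^\lambda(\theta)\le1$. "With probability at least $1-\delta$,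 for any stopping time $\tau$, [bound at $\tau$]" is equivalent to $P(\forall t\ge1:\text{[bound at }t])\ge1-\delta$. *)

theory Defs
  imports "HOL-Probability.Probability"
begin

locale filtered_prob_space = prob_space M + filtration "space M" F
  for M :: "'a measure" and F :: "nat \<Rightarrow> 'a measure" +
  assumes subalgebra_F: "subalgebra M (F t)"

definition adapted :: "(nat \<Rightarrow> 'a measure) \<Rightarrow> (nat \<Rightarrow> 'a \<Rightarrow> 'b::topological_space) \<Rightarrow> bool"
  where "adapted F X \<longleftrightarrow> (\<forall>t. X t \<in> borel_measurable (F t))"

definition supermartingale ::
  "'a measure \<Rightarrow> (nat \<Rightarrow> 'a measure) \<Rightarrow> (nat \<Rightarrow> 'a \<Rightarrow> real) \<Rightarrow> bool"
  where "supermartingale M F X \<longleftrightarrow>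
    adapted F X \<and>
    (\<forall>t. integrable M (X t)) \<and>
    (\<forall>s t. s \<le> t \<longrightarrow> (AE \<omega> in M. real_cond_exp M (F s) (X t) \<omega> \<le> X s \<omega>))"

text \<open>Positive definite matrices are symmetric by convention.\<close>

definition pos_def :: "real ^ 'n ^ 'n \<Rightarrow> bool"
  where "pos_def A \<longleftrightarrow> transpose A = A \<and> (\<forall>x. x \<noteq> 0 \<longrightarrow> x \<bullet> (A *v x) > 0)"

text \<open>The squared norm of \<open>v\<close> weighted by the positive semidefinite matrix \<open>A\<close>.\<close>

definition weighted_norm_sq :: "real ^ 'n ^ 'n \<Rightarrow> real ^ 'n \<Rightarrow> real"
  where "weighted_norm_sq A v = v \<bullet> (A *v v)"

text \<open>
  The domain of \<open>\<psi>\<close> is \<open>[0, lmax)\<close>, where \<open>lmax\<close> may be \<open>\<infinity>\<close>; values of \<open>\<psi>\<close> outside it are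
  never used.  The dominating supermartingale may depend on \<open>\<theta>\<close> and \<open>l\<close> in an arbitrary
  (possibly non-measurable) way, but not on \<open>t\<close>.  Relations between random variables are
  understood almost surely.
\<close>

definition sub_psi_process ::
  "'a measure \<Rightarrow> (nat \<Rightarrow> 'a measure) \<Rightarrow> (real \<Rightarrow> real) \<Rightarrow> ereal \<Rightarrow>
    (nat \<Rightarrow> 'a \<Rightarrow> real ^ 'n) \<Rightarrow> (nat \<Rightarrow> 'a \<Rightarrow> real ^ 'n ^ 'n) \<Rightarrow> bool"
  where "sub_psi_process M F \<psi> lmax S V \<longleftrightarrow>
    (\<forall>l::real. 0 \<le> l \<and> ereal l < lmax \<longrightarrow> 0 \<le> \<psi> l) \<and>
    adapted F S \<and> adapted F V \<and>
    (\<forall>t. AE \<omega> in M. pos_def (V t \<omega>)) \<and>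
    (\<forall>\<theta> \<in> sphere (0 :: real ^ 'n) 1. \<forall>l::real. 0 \<le> l \<and> ereal l < lmax \<longrightarrow>
      (\<exists>L. supermartingale M F L \<and>
           (\<forall>t. AE \<omega> in M. 0 \<le> L t \<omega>) \<and>
           (AE \<omega> in M. L 0 \<omega> \<le> 1) \<and>
           (\<forall>t. AE \<omega> in M.
              exp (l * (\<theta> \<bullet> S t \<omega>) - \<psi> l * (\<theta> \<bullet> (V t \<omega> *v \<theta>))) \<le> L t \<omega>)))"

definition sub_gaussian_process ::
  "'a measure \<Rightarrow> (nat \<Rightarrow> 'a measure) \<Rightarrow>
    (nat \<Rightarrow> 'a \<Rightarrow> real ^ 'n) \<Rightarrow> (nat \<Rightarrow> 'a \<Rightarrow> real ^ 'n ^ 'n) \<Rightarrow> bool"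
  where "sub_gaussian_process M F S V \<longleftrightarrow> sub_psi_process M F (\<lambda>l. l\<^sup>2 / 2) \<infinity> S V"

text \<open>
  A bound that holds at all stopping times with values in \<open>{1, 2, \<dots>}\<close> simultaneously is the same
  as a bound that holds at all times \<open>t \<ge> 1\<close> simultaneously.
\<close>

lemma all_stopping_times_iff_all_times:
  fixes F :: "nat \<Rightarrow> 'a measure"
  assumes "\<omega> \<in> \<Omega>"
  shows "(\<forall>\<tau>. stopping_time F \<tau> \<and> (\<forall>\<omega>'\<in>\<Omega>. 1 \<le> \<tau> \<omega>') \<longrightarrow> B (\<tau> \<omega>) \<omega>)
    \<longleftrightarrow> (\<forall>t\<ge>1. B t \<omega>)"
proof
  assume *: "\<forall>\<tau>. stopping_time F \<tau> \<and> (\<forall>\<omega>'\<in>\<Omega>. 1 \<le> \<tau> \<omega>') \<longrightarrow> B (\<tau> \<omega>) \<omega>"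
  show "\<forall>t\<ge>1. B t \<omega>"
  proof (intro allI impI)
    fix t :: nat assume "1 \<le> t"
    then show "B t \<omega>"
      using *[rule_format, of "\<lambda>_. t"] stopping_time_const[of F t] by simp
  qed
qed (use assms in blast)

end

theory Submission
  imports Defs
begin

text \<open>
  Write a vector \<open>u\<close> as \<open>l *\<^sub>R \<theta>\<close> with \<open>l = norm u\<close>: the process
  \<open>Y\<^sub>t(u) = exp (u \<bullet> S\<^sub>t - u \<bullet> V\<^sub>t u / 2)\<close> is dominated by a nonnegative supermartingale for every \<open>u\<close>.
  Integrating \<open>Y\<^sub>t(u)\<close> against the Gaussian weight \<open>exp (- u \<bullet> U0 u / 2)\<close> gives, up to a constant,
  \<open>det (V\<^sub>t + U0) powr (-1/2) * exp (\<parallel>S\<^sub>t\<parallel>\<^sup>2 / 2)\<close> with the norm weighted by \<open>(V\<^sub>t + U0)\<^sup>-\<^sup>1\<close>, and the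
  claim is Ville's maximal inequality for this mixture.  The dominating supermartingales need not be
  measurable in \<open>u\<close>, so they cannot be mixed.  Instead the events that the mixture of the \<open>Y\<^sub>t(u)\<close>
  first exceeds the level at time \<open>t\<close> do not depend on \<open>u\<close>, and on these the supermartingale
  inequality is applied for each fixed \<open>u\<close>, before Tonelli's theorem.
\<close>

section \<open>Linear change of variables for Lebesgue measure\<close>

text \<open>Lebesgue measure is the image of the product measure over the basis, so Tonelli's
  theorem splits off one coordinate.\<close>

lemma nn_integral_lborel_slice:
  fixes f :: "'a::euclidean_space \<Rightarrow> ennreal"
  assumes [measurable]: "f \<in> borel_measurable borel" and b: "b \<in> Basis"
  shows "(\<integral>\<^sup>+x. f x \<partial>lborel) =
    (\<integral>\<^sup>+x. (\<integral>\<^sup>+y. f ((\<Sum>c\<in>Basis - {b}. x c *\<^sub>R c) + y *\<^sub>R b) \<partial>lborel)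
      \<partial>(\<Pi>\<^sub>M c\<in>Basis - {b}. lborel))"
proof -
  interpret product_sigma_finite "\<lambda>_::'a. lborel :: real measure"
    by standard
  have ins: "insert b (Basis - {b}) = Basis"
    using b by auto
  have "(\<integral>\<^sup>+x. f x \<partial>lborel) =
      (\<integral>\<^sup>+x. f (\<Sum>c\<in>Basis. x c *\<^sub>R c) \<partial>(\<Pi>\<^sub>M c\<in>Basis. lborel))"
    by (subst lborel_eq) (simp add: nn_integral_distr)
  also have "\<dots> = (\<integral>\<^sup>+x. f (\<Sum>c\<in>Basis. x c *\<^sub>R c) \<partial>(\<Pi>\<^sub>M c\<in>insert b (Basis - {b}). lborel))"
    by (simp only: ins)
  also have "\<dots> = (\<integral>\<^sup>+x. (\<integral>\<^sup>+y. f (\<Sum>c\<in>Basis. (x(b := y)) c *\<^sub>R c) \<partial>lborel)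
      \<partial>(\<Pi>\<^sub>M c\<in>Basis - {b}. lborel))"
    by (intro product_nn_integral_insert) (simp_all add: ins)
  also have "(\<lambda>x y. \<Sum>c\<in>Basis. (x(b := y)) c *\<^sub>R c) =
      (\<lambda>x y. (\<Sum>c\<in>Basis - {b}. x c *\<^sub>R c) + y *\<^sub>R b)"
    using b by (auto simp: sum.remove[of Basis b] fun_eq_iff add.commute intro!: sum.cong)
  finally show ?thesis
    by (simp add: fun_eq_iff)
qed

text \<open>On each line parallel to \<open>b\<close> the map is a translation, by an amount
  \<open>x \<bullet> e\<close> that is constant along the line because \<open>e\<close> differs from
  \<open>b\<close>. One-dimensional translation invariance then suffices.\<close>

lemma nn_integral_lborel_shear:
  fixes f :: "'a::euclidean_space \<Rightarrow> ennreal"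
  assumes f[measurable]: "f \<in> borel_measurable borel"
    and b: "b \<in> Basis" and e: "e \<in> Basis" "e \<noteq> b"
  shows "(\<integral>\<^sup>+x. f (x + (x \<bullet> e) *\<^sub>R b) \<partial>lborel) = (\<integral>\<^sup>+x. f x \<partial>lborel)"
proof -
  let ?s = "\<lambda>x. \<Sum>c\<in>Basis - {b}. x c *\<^sub>R c"
  have "?s x \<bullet> e = x e" for x
    using e by (simp add: inner_sum_left inner_Basis if_distrib cong: if_cong)
  then have "?s x + y *\<^sub>R b + ((?s x + y *\<^sub>R b) \<bullet> e) *\<^sub>R b = ?s x + (x e + 1 * y) *\<^sub>R b" for x y
    using b e by (simp add: inner_add_left inner_Basis algebra_simps)
  moreover have "(\<integral>\<^sup>+y. f (?s x + (x e + 1 * y) *\<^sub>R b) \<partial>lborel)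
      = (\<integral>\<^sup>+y. f (?s x + y *\<^sub>R b) \<partial>lborel)" for x
    using nn_integral_real_affine[of "\<lambda>y. f (?s x + y *\<^sub>R b)" 1 "x e"] by simp
  moreover have "(\<lambda>x. f (x + (x \<bullet> e) *\<^sub>R b)) \<in> borel_measurable borel"
    by measurable
  ultimately show ?thesis
    by (simp only: nn_integral_lborel_slice[OF _ b] f)
qed

lemma nn_integral_lborel_translation:
  fixes f :: "'a::euclidean_space \<Rightarrow> ennreal"
  assumes [measurable]: "f \<in> borel_measurable borel"
  shows "(\<integral>\<^sup>+x. f (t + x) \<partial>lborel) = (\<integral>\<^sup>+x. f x \<partial>lborel)"
  by (subst (2) lborel_affine[of 1 t])
    (simp_all add: density_1 nn_integral_distr)

lemma nn_integral_lborel_stretch: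
  fixes f :: "real^'n \<Rightarrow> ennreal"
  assumes [measurable]: "f \<in> borel_measurable borel" and c: "\<And>i. c i \<noteq> 0"
  shows "(\<integral>\<^sup>+x. f x \<partial>lborel) = ennreal \<bar>prod c UNIV\<bar> * (\<integral>\<^sup>+x. f (\<chi> i. c i * x $ i) \<partial>lborel)"
proof -
  \<comment> \<open>The factors are reindexed by basis vectors, because the affine formula for
    \<open>lborel\<close> runs over \<open>Basis\<close>.\<close>
  define C :: "real^'n \<Rightarrow> real" where "C b = b \<bullet> (\<chi> i. c i)" for b
  have C[simp]: "C (axis i 1) = c i" for i
    by (simp add: C_def inner_axis')
  have Basis: "(Basis :: (real^'n) set) = range (\<lambda>i. axis i 1)"
    by (auto simp: Basis_vec_def)
  have inj: "inj (\<lambda>i::'n. axis i (1::real))"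
    by (auto intro!: injI simp: axis_eq_axis)
  have sum: "(\<Sum>j\<in>Basis. (C j * (x \<bullet> j)) *\<^sub>R j) = (\<chi> i. c i * x $ i)" for x
    unfolding Basis sum.reindex[OF inj] o_def C inner_axis
    by (simp add: vec_eq_iff) (simp add: axis_def if_distrib cong: if_cong)
  have prod: "(\<Prod>j\<in>Basis. \<bar>C j\<bar>) = \<bar>prod c UNIV\<bar>"
    by (simp add: Basis prod.reindex[OF inj] abs_prod)
  have [measurable]: "(\<lambda>x. \<chi> i. c i * x $ i) \<in> borel_measurable borel"
    by (intro borel_measurable_continuous_onI continuous_intros)
  have "lborel = density (distr lborel borel (\<lambda>x. 0 + (\<Sum>j\<in>Basis. (C j * (x \<bullet> j)) *\<^sub>R j)))
      (\<lambda>_. ennreal (\<Prod>j\<in>Basis. \<bar>C j\<bar>))"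
    by (rule lborel_affine_euclidean) (auto simp: Basis c)
  then have "(\<integral>\<^sup>+x. f x \<partial>lborel) = (\<integral>\<^sup>+x. f x \<partial>density (distr lborel borel (\<lambda>x. \<chi> i. c i * x $ i))
      (\<lambda>_. ennreal \<bar>prod c UNIV\<bar>))"
    by (simp only: sum prod add_0)
  then show ?thesis
    by (simp add: nn_integral_density nn_integral_distr nn_integral_cmult)
qed

text \<open>Lebesgue measure is determined by its values on boxes, and a permutation of coordinates
  pulls a box back to a box with permuted sides, hence of equal volume.\<close>

lemma nn_integral_lborel_permute:
  fixes f :: "real^'n \<Rightarrow> ennreal"
  assumes [measurable]: "f \<in> borel_measurable borel" and p: "p permutes UNIV"
  shows "(\<integral>\<^sup>+x. f (\<chi> i. x $ p i) \<partial>lborel) = (\<integral>\<^sup>+x. f x \<partial>lborel)"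
proof -
  let ?h = "\<lambda>x::real^'n. \<chi> i. x $ p i"
  have h[measurable]: "?h \<in> borel_measurable borel"
    by (intro borel_measurable_continuous_onI continuous_intros)
  have Basis: "(Basis :: (real^'n) set) = range (\<lambda>i. axis i 1)"
    by (auto simp: Basis_vec_def)
  have inj: "inj (\<lambda>i::'n. axis i (1::real))"
    by (auto intro!: injI simp: axis_eq_axis)
  have "lborel = distr lborel borel ?h"
  proof (rule lborel_eqI)
    fix l u :: "real^'n"
    assume le: "\<And>b. b \<in> Basis \<Longrightarrow> l \<bullet> b \<le> u \<bullet> b"
    let ?q = "\<lambda>x::real^'n. \<chi> i. x $ inv p i"
    have le': "l $ i \<le> u $ i" for i
      using le[of "axis i 1"] by (simp add: Basis inner_axis)
    have "?h -` box l u = box (?q l) (?q u)"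
      using p by (auto simp: mem_box_cart) (metis permutes_inverses)+
    then have "emeasure (distr lborel borel ?h) (box l u) = emeasure lborel (box (?q l) (?q u))"
      by (simp add: emeasure_distr)
    also have "\<dots> = ennreal (\<Prod>b\<in>Basis. (?q u - ?q l) \<bullet> b)"
      by (rule emeasure_lborel_box) (auto simp: Basis inner_axis le')
    also have "(\<Prod>b\<in>Basis. (?q u - ?q l) \<bullet> b) = (\<Prod>i\<in>UNIV. (u - l) $ inv p i)"
      by (simp add: Basis prod.reindex[OF inj] inner_axis)
    also have "\<dots> = (\<Prod>i\<in>UNIV. (u - l) $ i)"
      using prod.permute[OF permutes_inv[OF p], of "\<lambda>i. (u - l) $ i"] by (simp add: o_def)
    also have "\<dots> = (\<Prod>b\<in>Basis. (u - l) \<bullet> b)"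
      by (simp add: Basis prod.reindex[OF inj] inner_axis)
    finally show "emeasure (distr lborel borel ?h) (box l u) = (\<Prod>b\<in>Basis. (u - l) \<bullet> b)" .
  qed simp
  then have "(\<integral>\<^sup>+x. f x \<partial>lborel) = (\<integral>\<^sup>+x. f x \<partial>distr lborel borel ?h)"
    by simp
  then show ?thesis
    by (simp add: nn_integral_distr)
qed

text \<open>The change of variables theorems of HOL-Analysis require a well-ordered index type.\<close>

lemma nn_integral_lborel_linear:
  fixes h :: "real^'n \<Rightarrow> real^'n" and f :: "real^'n \<Rightarrow> ennreal"
  assumes "linear h" "det (matrix h) \<noteq> 0" "f \<in> borel_measurable borel"
  shows "(\<integral>\<^sup>+x. f x \<partial>lborel) = ennreal \<bar>det (matrix h)\<bar> * (\<integral>\<^sup>+x. f (h x) \<partial>lborel)"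
proof -
  \<comment> \<open>Induction over elementary maps. The determinant condition sits inside the
    predicate, so that maps killing a coordinate satisfy it vacuously; \<open>f\<close> is
    quantified inside because a composition needs the claim for \<open>f\<close> and also for
    \<open>f\<close> composed with \<open>g\<close>.\<close>
  have "det (matrix h) \<noteq> 0 \<longrightarrow> (\<forall>f\<in>borel_measurable borel.
      (\<integral>\<^sup>+x. f x \<partial>lborel) = ennreal \<bar>det (matrix h)\<bar> * (\<integral>\<^sup>+x. f (h x) \<partial>lborel))" (is "?P h")
  proof (rule induct_linear_elementary[OF \<open>linear h\<close>])
    fix g h :: "real^'n \<Rightarrow> real^'n"
    assume lin: "linear g" "linear h" and gh: "?P g" "?P h"
    show "?P (g \<circ> h)"
    proof (intro impI ballI)
      fix f :: "real^'n \<Rightarrow> ennreal"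
      assume "det (matrix (g \<circ> h)) \<noteq> 0" and f[measurable]: "f \<in> borel_measurable borel"
      then have det: "det (matrix g) \<noteq> 0" "det (matrix h) \<noteq> 0"
        using lin by (auto simp: matrix_compose det_mul)
      have [measurable]: "g \<in> borel_measurable borel"
        using lin(1) by (intro borel_measurable_continuous_onI linear_continuous_on)
          (simp add: linear_conv_bounded_linear)
      have "(\<integral>\<^sup>+x. f (g x) \<partial>lborel) = ennreal \<bar>det (matrix h)\<bar> * (\<integral>\<^sup>+x. f (g (h x)) \<partial>lborel)"
        using gh(2)[rule_format, OF det(2), of "\<lambda>x. f (g x)"] by simp
      moreover have "(\<integral>\<^sup>+x. f x \<partial>lborel) = ennreal \<bar>det (matrix g)\<bar> * (\<integral>\<^sup>+x. f (g x) \<partial>lborel)"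
        using gh(1)[rule_format, OF det(1) f] .
      ultimately show "(\<integral>\<^sup>+x. f x \<partial>lborel) =
          ennreal \<bar>det (matrix (g \<circ> h))\<bar> * (\<integral>\<^sup>+x. f ((g \<circ> h) x) \<partial>lborel)"
        using lin by (simp add: matrix_compose det_mul abs_mult ennreal_mult mult.assoc)
    qed
  next
    fix h :: "real^'n \<Rightarrow> real^'n" and i
    assume "linear h" and 0: "\<And>x. h x $ i = 0"
    have "row i (matrix h) = 0"
      by (simp add: row_def matrix_def 0 vec_eq_iff)
    then show "?P h"
      by (simp add: det_zero_row)
  next
    fix c :: "'n \<Rightarrow> real"
    have "det (matrix (\<lambda>x. \<chi> i. c i * x $ i)) = prod c UNIV"
      by (simp add: axis_def matrix_def det_diagonal)
    then show "?P (\<lambda>x. \<chi> i. c i * x $ i)"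
      by (auto simp: prod_zero_iff intro!: nn_integral_lborel_stretch)
  next
    fix m n :: 'n
    assume "m \<noteq> n"
    let ?t = "Transposition.transpose m n" and ?h = "\<lambda>v::real^'n. \<chi> i. v $ Transposition.transpose m n i"
    have "(\<chi> i j. if ?t i = j then 1 else 0) = (\<chi> i j. if j = ?t i then 1 else (0::real))"
      by (auto intro!: Cart_lambda_cong)
    \<comment> \<open>The matrix of the swap is the identity with permuted columns; its determinant
      is a sign, which the absolute value removes.\<close>
    then have "matrix ?h = transpose (\<chi> i j. mat 1 $ i $ ?t j)"
      by (auto simp: matrix_eq transpose_def axis_def mat_def matrix_def)
    then have "\<bar>det (matrix ?h)\<bar> = 1"
      by (simp add: det_permute_columns permutes_swap_id sign_swap_id abs_mult)
    then show "?P ?h"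
      by (simp add: nn_integral_lborel_permute permutes_swap_id)
  next
    fix m n :: 'n
    assume mn: "m \<noteq> n"
    let ?h = "\<lambda>v::real^'n. \<chi> i. if i = m then v $ m + v $ n else v $ i"
    \<comment> \<open>One row operation on the identity keeps the determinant at 1; the map itself
      is a shear.\<close>
    have "matrix ?h = (\<chi> k. if k = m then row m (mat 1 :: real^'n^'n) + 1 *s row n (mat 1) else row k (mat 1))"
      by (auto simp: matrix_def row_def vec_eq_iff axis_def mat_def)
    then have "det (matrix ?h) = 1"
      using det_row_operation[OF mn, of "mat 1 :: real^'n^'n" 1] by (simp only: det_I)
    moreover have "?h x = x + (x \<bullet> axis n 1) *\<^sub>R axis m 1" for x
      unfolding inner_axis by (auto simp: vec_eq_iff axis_def)
    ultimately show "?P ?h"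
      using mn by (simp add: nn_integral_lborel_shear axis_eq_axis)
  qed
  then show ?thesis
    using assms by blast
qed

section \<open>Positive definite matrices and Gaussian integrals\<close>

lemma inner_matrix_vector_mult_symmetric:
  fixes A :: "real^'n^'n"
  assumes "transpose A = A"
  shows "x \<bullet> (A *v y) = (A *v x) \<bullet> y"
  by (metis assms dot_lmul_matrix vector_transpose_matrix)

text \<open>Gram-Schmidt for the inner product given by \<open>A\<close>: as long as fewer vectors
  than the dimension are chosen, the \<open>A *v w i\<close> do not span the space. A nonzero vector
  orthogonal to all of them, divided by its \<open>A\<close>-norm, extends the family.\<close>

lemma pos_def_orthonormal:
  fixes A :: "real^'n^'n"
  assumes A: "pos_def A" and "k \<le> CARD('n)"
  shows "\<exists>w :: nat \<Rightarrow> real^'n. \<forall>i<k. \<forall>j<k. w i \<bullet> (A *v w j) = of_bool (i = j)"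
  using \<open>k \<le> CARD('n)\<close>
proof (induction k)
  case (Suc k)
  then obtain w :: "nat \<Rightarrow> real^'n" where w: "\<And>i j. i < k \<Longrightarrow> j < k \<Longrightarrow> w i \<bullet> (A *v w j) = of_bool (i = j)"
    by auto
  have sym: "transpose A = A"
    using A by (simp add: pos_def_def)
  let ?W = "(\<lambda>i. A *v w i) ` {..<k}"
  have "dim ?W \<le> card ?W"
    by (rule dim_le_card) (auto intro: span_base)
  also have "\<dots> \<le> k"
    using card_image_le[of "{..<k}" "\<lambda>i. A *v w i"] by simp
  also have "\<dots> < DIM(real^'n)"
    using Suc.prems by simp
  finally obtain x where "x \<noteq> 0" and x: "\<And>y. y \<in> span ?W \<Longrightarrow> orthogonal x y"
    using orthogonal_to_subspace_exists by metis
  define r where "r = sqrt (x \<bullet> (A *v x))"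
  have "x \<bullet> (A *v x) > 0"
    using A \<open>x \<noteq> 0\<close> by (simp add: pos_def_def)
  then have r: "r > 0" "x \<bullet> (A *v x) = r * r"
    by (auto simp: r_def)
  have xw: "x \<bullet> (A *v w i) = 0" if "i < k" for i
    using x[of "A *v w i"] that by (auto simp: orthogonal_def intro: span_base)
  then have wx: "w i \<bullet> (A *v x) = 0" if "i < k" for i
    using that inner_matrix_vector_mult_symmetric[OF sym, of "w i" x] by (simp add: inner_commute)
  define w' where "w' = w(k := x /\<^sub>R r)"
  have "\<forall>i<Suc k. \<forall>j<Suc k. w' i \<bullet> (A *v w' j) = of_bool (i = j)"
    using w r xw wx by (auto simp: w'_def less_Suc_eq matrix_vector_mult_scaleR field_simps)
  then show ?case
    by blast
qed auto

lemma matrix_mult_transpose_component: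
  fixes A :: "real^'n^'n"
  shows "(P ** A ** transpose P) $ i $ j = row i P \<bullet> (A *v row j P)"
proof -
  have "(P ** A ** transpose P) $ i $ j = (\<Sum>k\<in>UNIV. \<Sum>l\<in>UNIV. P $ i $ l * A $ l $ k * P $ j $ k)"
    by (simp add: matrix_matrix_mult_def transpose_def sum_distrib_right)
  also have "\<dots> = (\<Sum>l\<in>UNIV. \<Sum>k\<in>UNIV. P $ i $ l * A $ l $ k * P $ j $ k)"
    by (rule sum.swap)
  also have "\<dots> = row i P \<bullet> (A *v row j P)"
    by (simp add: inner_vec_def matrix_vector_mult_def row_def sum_distrib_left mult.assoc)
  finally show ?thesis .
qed

text \<open>The rows of \<open>P\<close> are a basis orthonormal for the form of \<open>A\<close>,
  and the entries of the product are the values of that form on pairs of rows.\<close>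

lemma pos_def_congruent_identity:
  fixes A :: "real^'n^'n"
  assumes "pos_def A"
  obtains P :: "real^'n^'n" where "P ** A ** transpose P = mat 1"
proof -
  obtain w :: "nat \<Rightarrow> real^'n"
    where w: "\<And>i j. i < CARD('n) \<Longrightarrow> j < CARD('n) \<Longrightarrow> w i \<bullet> (A *v w j) = of_bool (i = j)"
    using pos_def_orthonormal[OF assms order_refl] by auto
  obtain e :: "'n \<Rightarrow> nat" where e: "bij_betw e UNIV {..<CARD('n)}"
    by (metis finite_code ex_bij_betw_finite_nat atLeast0LessThan)
  then have "e i < CARD('n)" "e i = e j \<longleftrightarrow> i = j" for i j
    by (auto simp: bij_betw_def inj_on_def)
  then have "(\<chi> i. w (e i)) ** A ** transpose (\<chi> i. w (e i)) = mat 1"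
    using w by (simp add: vec_eq_iff matrix_mult_transpose_component mat_def row_def)
  then show ?thesis
    by (rule that)
qed

lemma pos_def_det_pos:
  fixes A :: "real^'n^'n"
  assumes "pos_def A"
  shows "det A > 0"
proof -
  obtain P :: "real^'n^'n" where "P ** A ** transpose P = mat 1"
    using pos_def_congruent_identity[OF assms] .
  then have "det (P ** A ** transpose P) = 1"
    by (simp only: det_I)
  then have "(det P)\<^sup>2 * det A = 1"
    by (simp add: det_mul power2_eq_square mult_ac)
  then show ?thesis
    using zero_less_mult_pos[of "(det P)\<^sup>2" "det A"] by (cases "det P = 0") auto
qed

lemma pos_def_add:
  "pos_def A \<Longrightarrow> pos_def B \<Longrightarrow> pos_def (A + B)"
  unfolding pos_def_def
proof (intro conjI allI impI; elim conjE)
  assume "transpose A = A" "transpose B = B"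
  then show "transpose (A + B) = A + B"
    by (simp add: transpose_def vec_eq_iff)
qed (simp add: matrix_vector_mult_add_rdistrib inner_add_right add_pos_pos)

lemma matrix_vector_mult_matrix_inv:
  fixes A :: "real^'n^'n"
  assumes "det A \<noteq> 0"
  shows "A *v (matrix_inv A *v x) = x"
proof -
  have "\<exists>A'. A ** A' = mat 1 \<and> A' ** A = mat 1"
    using assms unfolding invertible_det_nz[symmetric] invertible_def .
  then have "A ** matrix_inv A = mat 1"
    unfolding matrix_inv_def by (rule someI2_ex) blast
  then show ?thesis
    by (simp add: matrix_vector_mul_assoc)
qed

text \<open>A positive function cannot have integral 0 for a nonzero measure. Finiteness holds
  because the integrand factors over the coordinates into multiples of the normal density. The
  constant \<open>c\<close> will occur both in the mass of the mixing measure and in the mixture,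
  and drops out.\<close>

lemma nn_integral_standard_gaussian:
  defines "c \<equiv> (\<integral>\<^sup>+x. ennreal (exp (- ((x::'a::euclidean_space) \<bullet> x) / 2)) \<partial>lborel)"
  shows "0 < c" "c < \<infinity>"
proof -
  have "c \<noteq> 0"
  proof
    assume "c = 0"
    then have "AE x in (lborel :: 'a measure). False"
      by (simp add: c_def nn_integral_0_iff_AE not_le)
    then show False
      by (simp add: AE_iff_null null_sets_def)
  qed
  then show "0 < c"
    by (simp add: zero_less_iff_neq_zero)
  have gauss: "(\<integral>\<^sup>+y. ennreal (exp (- y\<^sup>2 / 2)) \<partial>lborel) < \<infinity>"
  proof -
    have "(\<integral>\<^sup>+y. ennreal (exp (- y\<^sup>2 / 2)) \<partial>lborel)
      = (\<integral>\<^sup>+y. ennreal (sqrt (2 * pi)) * ennreal (std_normal_density y) \<partial>lborel)"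
      by (intro nn_integral_cong) (simp add: std_normal_density_def flip: ennreal_mult)
    also have "\<dots> = ennreal (sqrt (2 * pi)) * (\<integral>\<^sup>+y. ennreal (std_normal_density y) \<partial>lborel)"
      by (rule nn_integral_cmult) simp
    also have "\<dots> = ennreal (sqrt (2 * pi)) * ennreal 1"
      by (subst nn_integral_eq_integral) simp_all
    finally show ?thesis
      by simp
  qed
  have "x \<bullet> x = (\<Sum>b\<in>Basis. (x \<bullet> b)\<^sup>2)" for x :: 'a
    by (subst euclidean_inner) (simp add: power2_eq_square)
  then have "exp (- (x \<bullet> x) / 2) = (\<Prod>b\<in>Basis. exp (- (x \<bullet> b)\<^sup>2 / 2))" for x :: 'a
    by (simp add: sum_negf sum_divide_distrib flip: exp_sum)
  then have "c = (\<Prod>b\<in>(Basis :: 'a set). \<integral>\<^sup>+y. ennreal (exp (- y\<^sup>2 / 2)) \<partial>lborel)"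
    unfolding c_def by (subst nn_integral_lborel_prod[symmetric]) (auto simp: prod_ennreal)
  also have "\<dots> < \<infinity>"
    using gauss by (simp add: power_less_top_ennreal)
  finally show "c < \<infinity>" .
qed

text \<open>The affine substitution that completes the square and makes \<open>A\<close> the
  identity reduces this to the standard Gaussian. The factor with \<open>det A\<close> stands on the
  left so that nothing is divided in \<open>ennreal\<close>.\<close>

lemma nn_integral_gaussian:
  fixes A :: "real^'n^'n"
  assumes A: "pos_def A"
  shows "ennreal (sqrt (det A)) * (\<integral>\<^sup>+u. ennreal (exp (u \<bullet> s - u \<bullet> (A *v u) / 2)) \<partial>lborel)
    = ennreal (exp (weighted_norm_sq (matrix_inv A) s / 2)) *
      (\<integral>\<^sup>+u. ennreal (exp (- ((u::real^'n) \<bullet> u) / 2)) \<partial>lborel)"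
proof -
  obtain P :: "real^'n^'n" where P: "P ** A ** transpose P = mat 1"
    using pos_def_congruent_identity[OF A] .
  have sym: "transpose A = A"
    using A by (simp add: pos_def_def)
  have detA: "det A > 0"
    by (rule pos_def_det_pos[OF A])
  have "det (P ** A ** transpose P) = 1"
    by (simp add: P)
  then have "(det P)\<^sup>2 * det A = 1"
    by (simp add: det_mul power2_eq_square mult_ac)
  then have "sqrt ((det P)\<^sup>2 * det A) = 1"
    by simp
  \<comment> \<open>The Jacobian of the substitution is thus the inverse square root of
    \<open>det A\<close>.\<close>
  then have detP: "\<bar>det P\<bar> * sqrt (det A) = 1"
    by (simp add: real_sqrt_mult)
  define f where "f u = ennreal (exp (u \<bullet> s - u \<bullet> (A *v u) / 2))" for u
  define m where "m = matrix_inv A *v s"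
  have s: "A *v m = s"
    using matrix_vector_mult_matrix_inv[of A s] detA by (simp add: m_def)
  have f[measurable]: "f \<in> borel_measurable borel"
    unfolding f_def matrix_vector_mult_def inner_vec_def
    by (intro measurable_compose[OF _ measurable_ennreal] borel_measurable_continuous_onI continuous_intros) auto
  have shift: "f (m + transpose P *v u) = ennreal (exp (s \<bullet> m / 2)) * ennreal (exp (- (u \<bullet> u) / 2))" for u
  proof -
    define v where "v = transpose P *v u"
    have "v \<bullet> (A *v v) = u \<bullet> ((P ** A ** transpose P) *v u)"
      unfolding v_def by (metis dot_lmul_matrix matrix_vector_mul_assoc transpose_matrix_vector)
    then have 1: "v \<bullet> (A *v v) = u \<bullet> u"
      by (simp add: P)
    have 2: "m \<bullet> (A *v v) = s \<bullet> v"
      by (simp add: inner_matrix_vector_mult_symmetric[OF sym] s)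
    \<comment> \<open>Completing the square: \<open>m\<close> is the maximiser of the exponent, so
      the terms linear in \<open>v\<close> cancel by \<open>A *v m = s\<close>.\<close>
    have "(m + v) \<bullet> s - (m + v) \<bullet> (A *v (m + v)) / 2 = s \<bullet> m / 2 + - (u \<bullet> u) / 2"
      by (simp add: matrix_vector_right_distrib inner_add_left inner_add_right 1 2 s)
        (simp add: inner_commute field_simps)
    then show ?thesis
      unfolding f_def v_def[symmetric] by (simp only: exp_add ennreal_mult exp_ge_zero)
  qed
  have "det P \<noteq> 0"
    using detP by auto
  have lin: "linear ((*v) (transpose P))"
    by simp
  have "(\<integral>\<^sup>+u. f u \<partial>lborel) = (\<integral>\<^sup>+u. f (m + u) \<partial>lborel)"
    by (rule nn_integral_lborel_translation[symmetric]) simp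
  also have "\<dots> = ennreal \<bar>det P\<bar> * (\<integral>\<^sup>+u. f (m + transpose P *v u) \<partial>lborel)"
    using nn_integral_lborel_linear[OF lin, of "\<lambda>u. f (m + u)"] \<open>det P \<noteq> 0\<close> by simp
  also have "\<dots> = ennreal \<bar>det P\<bar> * (ennreal (exp (s \<bullet> m / 2)) * (\<integral>\<^sup>+u. ennreal (exp (- ((u::real^'n) \<bullet> u) / 2)) \<partial>lborel))"
    unfolding shift by (simp add: nn_integral_cmult)
  finally have "ennreal (sqrt (det A)) * (\<integral>\<^sup>+u. f u \<partial>lborel)
      = ennreal (\<bar>det P\<bar> * sqrt (det A)) * (ennreal (exp (s \<bullet> m / 2)) * (\<integral>\<^sup>+u. ennreal (exp (- ((u::real^'n) \<bullet> u) / 2)) \<partial>lborel))"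
    using detA by (simp add: ennreal_mult mult_ac)
  then show ?thesis
    by (simp add: detP f_def weighted_norm_sq_def m_def)
qed

section \<open>A maximal inequality for mixtures\<close>

text \<open>Over an event of \<open>F s\<close>, \<open>L t\<close> and its conditional expectation
  given \<open>F s\<close> have the same integral. Nonnegativity permits passing between Bochner and
  nonnegative integrals.\<close>

lemma supermartingale_nn_integral_mono:
  assumes "filtered_prob_space M F" and L: "supermartingale M F L"
    and nonneg: "\<And>t. AE \<omega> in M. 0 \<le> L t \<omega>"
    and B: "B \<in> sets (F s)" and "s \<le> t"
  shows "(\<integral>\<^sup>+\<omega>. ennreal (L t \<omega>) * indicator B \<omega> \<partial>M) \<le> (\<integral>\<^sup>+\<omega>. ennreal (L s \<omega>) * indicator B \<omega> \<partial>M)"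
proof -
  interpret filtered_prob_space M F by fact
  interpret finite_measure_subalgebra M "F s"
    by standard (rule subalgebra_F)
  have [measurable]: "B \<in> sets M"
    using subalgebra_F[of s] B by (auto simp: subalgebra_def)
  have int[intro]: "integrable M (L t)" for t
    using L by (simp add: supermartingale_def)
  have intB: "integrable M (\<lambda>\<omega>. indicator B \<omega> * L t \<omega>)" for t
    using integrable_mult_indicator[OF \<open>B \<in> sets M\<close> int[of t]] by simp
  have nn: "(\<integral>\<^sup>+\<omega>. ennreal (L t \<omega>) * indicator B \<omega> \<partial>M) = ennreal (\<integral>\<omega>\<in>B. L t \<omega> \<partial>M)" for t
  proof -
    have "(\<integral>\<^sup>+\<omega>. ennreal (L t \<omega>) * indicator B \<omega> \<partial>M) = (\<integral>\<^sup>+\<omega>. ennreal (indicator B \<omega> * L t \<omega>) \<partial>M)"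
      by (intro nn_integral_cong) (simp split: split_indicator)
    also have "\<dots> = ennreal (\<integral>\<omega>. indicator B \<omega> * L t \<omega> \<partial>M)"
      using nonneg[of t] by (intro nn_integral_eq_integral intB) (auto split: split_indicator)
    finally show ?thesis
      by (simp add: set_lebesgue_integral_def)
  qed
  have "(\<integral>\<omega>\<in>B. L t \<omega> \<partial>M) = (\<integral>\<omega>\<in>B. real_cond_exp M (F s) (L t) \<omega> \<partial>M)"
    by (rule real_cond_exp_intA[OF int B])
  also have "\<dots> \<le> (\<integral>\<omega>\<in>B. L s \<omega> \<partial>M)"
    unfolding set_lebesgue_integral_def
  proof (rule integral_mono_AE)
    show "integrable M (\<lambda>\<omega>. indicator B \<omega> *\<^sub>R real_cond_exp M (F s) (L t) \<omega>)"
      by (intro integrable_mult_indicator real_cond_exp_int(1) int) simp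
    show "integrable M (\<lambda>\<omega>. indicator B \<omega> *\<^sub>R L s \<omega>)"
      using intB by simp
    have "AE \<omega> in M. real_cond_exp M (F s) (L t) \<omega> \<le> L s \<omega>"
      using L \<open>s \<le> t\<close> by (simp add: supermartingale_def)
    then show "AE \<omega> in M. indicator B \<omega> *\<^sub>R real_cond_exp M (F s) (L t) \<omega> \<le> indicator B \<omega> *\<^sub>R L s \<omega>"
      by (auto split: split_indicator)
  qed
  finally show ?thesis
    unfolding nn by (rule ennreal_leI)
qed

text \<open>Optional stopping in terms of events: \<open>A t\<close> is read as stopping at time
  \<open>t\<close>, and the sum is the expectation of the stopped value on the event of stopping by
  time \<open>n\<close>.\<close>

lemma supermartingale_sum_disjoint_le:
  assumes fps: "filtered_prob_space M F" and L: "supermartingale M F L"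
    and nonneg: "\<And>t. AE \<omega> in M. 0 \<le> L t \<omega>"
    and A: "\<And>t. A t \<in> sets (F t)" and disj: "disjoint_family A"
  shows "(\<Sum>t\<le>n. \<integral>\<^sup>+\<omega>. ennreal (L t \<omega>) * indicator (A t) \<omega> \<partial>M) \<le> (\<integral>\<^sup>+\<omega>. ennreal (L 0 \<omega>) \<partial>M)"
proof -
  interpret filtered_prob_space M F by fact
  define B where "B n = space M - (\<Union>t\<le>n. A t)" for n
  have AF: "A t \<in> sets (F n)" if "t \<le> n" for t n
    using A sets_F_mono[OF that] by auto
  have BF: "B n \<in> sets (F n)" for n
    unfolding B_def using AF by (intro sets.Diff sets.finite_UN) (auto simp flip: space_F[of n])
  have FM: "sets (F n) \<subseteq> sets M" for n
    using subalgebra_F by (simp add: subalgebra_def)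
  have [measurable]: "A n \<in> sets M" "B n \<in> sets M" for n
    using A BF FM by blast+
  have [measurable]: "L n \<in> borel_measurable M" for n
    using L by (auto simp: supermartingale_def)
  have A_space: "A n \<subseteq> space M" for n
    using sets.sets_into_space by measurable
  \<comment> \<open>The induction also carries the mass of \<open>L n\<close> on \<open>B n\<close>,
    the event of not having stopped by time \<open>n\<close>; the supermartingale inequality is
    applied to this term.\<close>
  have "(\<Sum>t\<le>n. \<integral>\<^sup>+\<omega>. ennreal (L t \<omega>) * indicator (A t) \<omega> \<partial>M)
      + (\<integral>\<^sup>+\<omega>. ennreal (L n \<omega>) * indicator (B n) \<omega> \<partial>M) \<le> (\<integral>\<^sup>+\<omega>. ennreal (L 0 \<omega>) \<partial>M)"
  proof (induction n)
    case 0
    have "(\<integral>\<^sup>+\<omega>. ennreal (L 0 \<omega>) * indicator (A 0) \<omega> \<partial>M) + (\<integral>\<^sup>+\<omega>. ennreal (L 0 \<omega>) * indicator (B 0) \<omega> \<partial>M)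
        = (\<integral>\<^sup>+\<omega>. ennreal (L 0 \<omega>) \<partial>M)"
      by (subst nn_integral_add[symmetric])
        (auto simp: B_def split: split_indicator intro!: nn_integral_cong)
    then show ?case
      by simp
  next
    case (Suc n)
    have split: "indicator (A (Suc n)) \<omega> + indicator (B (Suc n)) \<omega> = (indicator (B n) \<omega> :: ennreal)"
      if "\<omega> \<in> space M" for \<omega>
    proof -
      have "\<omega> \<notin> A t" if "\<omega> \<in> A (Suc n)" "t \<le> n" for t
        using disjoint_family_onD[OF disj, of "Suc n" t] that by auto
      then show ?thesis
        using that by (auto simp: B_def atMost_Suc split: split_indicator)
    qed
    have "(\<integral>\<^sup>+\<omega>. ennreal (L (Suc n) \<omega>) * indicator (A (Suc n)) \<omega> \<partial>M)
        + (\<integral>\<^sup>+\<omega>. ennreal (L (Suc n) \<omega>) * indicator (B (Suc n)) \<omega> \<partial>M)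
        = (\<integral>\<^sup>+\<omega>. ennreal (L (Suc n) \<omega>) * indicator (B n) \<omega> \<partial>M)"
      by (subst nn_integral_add[symmetric])
        (auto simp: split simp flip: distrib_left intro!: nn_integral_cong)
    also have "\<dots> \<le> (\<integral>\<^sup>+\<omega>. ennreal (L n \<omega>) * indicator (B n) \<omega> \<partial>M)"
      by (rule supermartingale_nn_integral_mono[OF fps L nonneg BF]) simp
    finally have "(\<Sum>t\<le>Suc n. \<integral>\<^sup>+\<omega>. ennreal (L t \<omega>) * indicator (A t) \<omega> \<partial>M)
        + (\<integral>\<^sup>+\<omega>. ennreal (L (Suc n) \<omega>) * indicator (B (Suc n)) \<omega> \<partial>M)
      \<le> (\<Sum>t\<le>n. \<integral>\<^sup>+\<omega>. ennreal (L t \<omega>) * indicator (A t) \<omega> \<partial>M)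
        + (\<integral>\<^sup>+\<omega>. ennreal (L n \<omega>) * indicator (B n) \<omega> \<partial>M)"
      by (simp add: add.assoc add_left_mono)
    then show ?case
      using Suc.IH by (rule order_trans)
  qed
  then show ?thesis
    by (rule order_trans[rotated]) simp
qed

text \<open>Ville's inequality by decomposition at the first time the mixture reaches
  \<open>K\<close>. On \<open>A t\<close> the mixture is at least \<open>K\<close>; after Tonelli,
  optional stopping bounds the total by 1 for each fixed \<open>u\<close>, and integration over
  \<open>N\<close> gives the mass of \<open>N\<close>.\<close>

lemma mixture_maximal_inequality:
  fixes Y :: "nat \<Rightarrow> 'b \<Rightarrow> 'a \<Rightarrow> real" and K :: ennreal
  assumes fps: "filtered_prob_space M F" and N: "sigma_finite_measure N"
    and Y: "\<And>t. (\<lambda>(u, \<omega>). Y t u \<omega>) \<in> borel_measurable (N \<Otimes>\<^sub>M F t)"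
    and dom: "\<And>u. u \<in> space N \<Longrightarrow> \<exists>L. supermartingale M F L \<and> (\<forall>t. AE \<omega> in M. 0 \<le> L t \<omega>) \<and>
      (AE \<omega> in M. L 0 \<omega> \<le> 1) \<and> (\<forall>t. AE \<omega> in M. Y t u \<omega> \<le> L t \<omega>)"
  defines "H \<equiv> {\<omega> \<in> space M. \<exists>t. K \<le> (\<integral>\<^sup>+u. ennreal (Y t u \<omega>) \<partial>N)}"
  shows "H \<in> sets M" and "K * emeasure M H \<le> emeasure N (space N)"
proof -
  interpret filtered_prob_space M F by fact
  interpret N: sigma_finite_measure N by fact
  interpret pair_sigma_finite N M by standard
  define Z where "Z t \<omega> = (\<integral>\<^sup>+u. ennreal (Y t u \<omega>) \<partial>N)" for t \<omega>
  define G where "G t = {\<omega> \<in> space M. K \<le> Z t \<omega>}" for t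
  \<comment> \<open>\<open>A t\<close> is \<open>G t\<close> minus all earlier \<open>G s\<close>:
    the mixture reaches \<open>K\<close> for the first time at \<open>t\<close>.\<close>
  define A where "A = disjointed G"
  have ZF: "Z t \<in> borel_measurable (F t)" for t
  proof -
    have "(\<lambda>(\<omega>, u). Y t u \<omega>) \<in> borel_measurable (F t \<Otimes>\<^sub>M N)"
      using measurable_compose[OF measurable_pair_swap' Y[of t]] by (simp add: case_prod_beta')
    then show ?thesis
      unfolding Z_def by (intro N.borel_measurable_nn_integral) (simp add: case_prod_beta')
  qed
  have subset: "sets (F n) \<subseteq> sets M" and id: "(\<lambda>\<omega>. \<omega>) \<in> M \<rightarrow>\<^sub>M F n" for n
    using subalgebra_F[of n] measurable_from_subalg[OF subalgebra_F measurable_ident, of n]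
    by (simp_all add: subalgebra_def id_def)
  have GF: "G t \<in> sets (F n)" if "t \<le> n" for t n
  proof -
    have "G t = {\<omega> \<in> space (F t). K \<le> Z t \<omega>}"
      by (simp add: G_def space_F)
    also have "\<dots> \<in> sets (F t)"
      using ZF by measurable
    finally show ?thesis
      using sets_F_mono[OF that] by auto
  qed
  have AF: "A t \<in> sets (F t)" for t
    unfolding A_def disjointed_def using GF by (intro sets.Diff sets.finite_UN) auto
  have disj: "disjoint_family A"
    unfolding A_def by (rule disjoint_family_disjointed)
  have [measurable]: "A t \<in> sets M" for t
    using AF subset by blast
  have [measurable]: "(\<lambda>(u, \<omega>). Y t u \<omega>) \<in> borel_measurable (N \<Otimes>\<^sub>M M)" for t
  proof -
    have "(\<lambda>x. (fst x, snd x)) \<in> N \<Otimes>\<^sub>M M \<rightarrow>\<^sub>M N \<Otimes>\<^sub>M F t"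
      by (intro measurable_Pair measurable_fst measurable_compose[OF measurable_snd id])
    from measurable_compose[OF this Y] show ?thesis
      by (simp add: case_prod_beta')
  qed
  have step: "K * emeasure M (A t) \<le> (\<integral>\<^sup>+u. \<integral>\<^sup>+\<omega>. ennreal (Y t u \<omega>) * indicator (A t) \<omega> \<partial>M \<partial>N)" for t
  proof -
    have "K * emeasure M (A t) = (\<integral>\<^sup>+\<omega>. K * indicator (A t) \<omega> \<partial>M)"
      by (simp add: nn_integral_cmult_indicator)
    also have "\<dots> \<le> (\<integral>\<^sup>+\<omega>. Z t \<omega> * indicator (A t) \<omega> \<partial>M)"
      by (intro nn_integral_mono) (auto simp: A_def disjointed_def G_def split: split_indicator)
    also have "\<dots> = (\<integral>\<^sup>+\<omega>. \<integral>\<^sup>+u. ennreal (Y t u \<omega>) * indicator (A t) \<omega> \<partial>N \<partial>M)"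
      unfolding Z_def by (intro nn_integral_cong nn_integral_multc[symmetric]) measurable
    also have "\<dots> = (\<integral>\<^sup>+u. \<integral>\<^sup>+\<omega>. ennreal (Y t u \<omega>) * indicator (A t) \<omega> \<partial>M \<partial>N)"
      by (rule Fubini') measurable
    finally show ?thesis .
  qed
  have partial_sum: "(\<Sum>t<n. K * emeasure M (A t)) \<le> emeasure N (space N)" for n
  proof -
    have "(\<Sum>t<n. K * emeasure M (A t))
        \<le> (\<Sum>t<n. \<integral>\<^sup>+u. \<integral>\<^sup>+\<omega>. ennreal (Y t u \<omega>) * indicator (A t) \<omega> \<partial>M \<partial>N)"
      by (intro sum_mono step)
    also have "\<dots> = (\<integral>\<^sup>+u. (\<Sum>t<n. \<integral>\<^sup>+\<omega>. ennreal (Y t u \<omega>) * indicator (A t) \<omega> \<partial>M) \<partial>N)"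
      by (rule nn_integral_sum[symmetric]) measurable
    also have "\<dots> \<le> (\<integral>\<^sup>+u. 1 \<partial>N)"
    proof (rule nn_integral_mono)
      fix u assume "u \<in> space N"
      \<comment> \<open>\<open>L\<close> is chosen for this single \<open>u\<close>. It enters only
        an estimate by the constant 1, so its dependence on \<open>u\<close> is never
        integrated.\<close>
      then obtain L where L: "supermartingale M F L" "\<And>t. AE \<omega> in M. 0 \<le> L t \<omega>"
          "AE \<omega> in M. L 0 \<omega> \<le> 1" "\<And>t. AE \<omega> in M. Y t u \<omega> \<le> L t \<omega>"
        using dom by meson
      have "(\<Sum>t<n. \<integral>\<^sup>+\<omega>. ennreal (Y t u \<omega>) * indicator (A t) \<omega> \<partial>M)
          \<le> (\<Sum>t<n. \<integral>\<^sup>+\<omega>. ennreal (L t \<omega>) * indicator (A t) \<omega> \<partial>M)"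
      proof (intro sum_mono nn_integral_mono_AE)
        fix t
        show "AE \<omega> in M. ennreal (Y t u \<omega>) * indicator (A t) \<omega> \<le> ennreal (L t \<omega>) * indicator (A t) \<omega>"
          using L(4)[of t] by eventually_elim (auto intro: ennreal_leI mult_right_mono)
      qed
      \<comment> \<open>One more nonnegative term passes from \<open>t < n\<close>, as used for
        partial sums of a series, to \<open>t \<le> n\<close>.\<close>
      also have "\<dots> \<le> (\<Sum>t\<le>n. \<integral>\<^sup>+\<omega>. ennreal (L t \<omega>) * indicator (A t) \<omega> \<partial>M)"
        by (intro sum_mono2) auto
      also have "\<dots> \<le> (\<integral>\<^sup>+\<omega>. ennreal (L 0 \<omega>) \<partial>M)"
        by (rule supermartingale_sum_disjoint_le[OF fps L(1,2) AF disj])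
      also have "\<dots> \<le> (\<integral>\<^sup>+\<omega>. 1 \<partial>M)"
        using L(3) by (intro nn_integral_mono_AE) (auto elim!: eventually_mono)
      also have "\<dots> = 1"
        by (simp add: emeasure_space_1)
      finally show "(\<Sum>t<n. \<integral>\<^sup>+\<omega>. ennreal (Y t u \<omega>) * indicator (A t) \<omega> \<partial>M) \<le> 1" .
    qed
    finally show ?thesis
      by simp
  qed
  have H: "H = (\<Union>t. G t)"
    by (auto simp: H_def G_def Z_def)
  moreover have "G t \<in> sets M" for t
    using GF[OF order_refl] subset by blast
  ultimately show "H \<in> sets M"
    by auto
  have "H = (\<Union>t. A t)"
    unfolding A_def H by (rule UN_disjointed_eq[symmetric])
  then have "K * emeasure M H = K * (\<Sum>t. emeasure M (A t))"
    by (simp add: suminf_emeasure[OF _ disj] image_subset_iff)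
  also have "\<dots> = (\<Sum>t. K * emeasure M (A t))"
    by simp
  also have "\<dots> \<le> emeasure N (space N)"
    by (rule suminf_le_const[OF _ partial_sum]) simp
  finally show "K * emeasure M H \<le> emeasure N (space N)" .
qed

section \<open>The self-normalised bound\<close>

lemma continuous_on_det:
  fixes f :: "'a::topological_space \<Rightarrow> real^'n^'n"
  assumes "\<And>i j. continuous_on S (\<lambda>x. f x $ i $ j)"
  shows "continuous_on S (\<lambda>x. det (f x))"
  unfolding det_def
  by (intro continuous_on_sum continuous_on_mult continuous_on_const continuous_on_prod assms)

lemma borel_measurable_vec_nth [measurable]:
  "(\<lambda>x. x $ i) \<in> borel_measurable (borel :: ('a::topological_space ^ 'n) measure)"
  by (intro borel_measurable_continuous_onI continuous_intros)

text \<open>For singular matrices \<open>matrix_inv\<close> is one fixed junk value, so it is measurable there too.\<close>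

lemma matrix_inv_singular:
  fixes A :: "real^'n^'n"
  assumes "det A = 0"
  shows "matrix_inv A = matrix_inv 0"
proof -
  have "det (0 :: real^'n^'n) = 0"
    by (rule det_zero_row(1)[of undefined]) (simp add: row_def vec_eq_iff)
  then show ?thesis
    using assms unfolding matrix_inv_def
    by (metis (no_types, opaque_lifting) invertible_def invertible_det_nz)
qed

text \<open>Cramer's rule writes the inverse applied to \<open>s\<close> through quotients of
  determinants. \<open>D k\<close>, the determinant with column \<open>k\<close> replaced by
  \<open>s\<close>, is continuous in the matrix and the vector.\<close>

lemma borel_measurable_weighted_norm_sq_matrix_inv [measurable]:
  fixes A :: "'a \<Rightarrow> real^'n^'n" and s :: "'a \<Rightarrow> real^'n"
  assumes [measurable]: "A \<in> borel_measurable M" "s \<in> borel_measurable M"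
  shows "(\<lambda>\<omega>. weighted_norm_sq (matrix_inv (A \<omega>)) (s \<omega>)) \<in> borel_measurable M"
proof -
  define D :: "'n \<Rightarrow> (real^'n^'n) \<times> (real^'n) \<Rightarrow> real"
    where "D k = (\<lambda>(A, s). det (\<chi> i j. if j = k then s $ i else A $ i $ j))" for k
  have "continuous_on UNIV (D k)" for k
    unfolding D_def case_prod_beta'
  proof (rule continuous_on_det)
    show "continuous_on UNIV (\<lambda>x. (\<chi> i j. if j = k then snd x $ i else fst x $ i $ j) $ i $ j)" for i j
      by (cases "j = k") (auto intro!: continuous_intros)
  qed
  then have [measurable]: "D k \<in> borel_measurable borel" for k
    by (rule borel_measurable_continuous_onI)
  have [measurable]: "(\<lambda>A. det A) \<in> borel_measurable (borel :: (real^'n^'n) measure)"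
    by (intro borel_measurable_continuous_onI continuous_on_det continuous_intros)
  have [measurable]: "(\<lambda>s. s \<bullet> (matrix_inv 0 *v s)) \<in> borel_measurable (borel :: (real^'n) measure)"
    by (intro borel_measurable_continuous_onI continuous_intros matrix_vector_mult_linear_continuous_on)
  have "weighted_norm_sq (matrix_inv (A \<omega>)) (s \<omega>) = (if det (A \<omega>) = 0 then s \<omega> \<bullet> (matrix_inv 0 *v s \<omega>)
      else \<Sum>k\<in>UNIV. s \<omega> $ k * (D k (A \<omega>, s \<omega>) / det (A \<omega>)))" for \<omega>
  proof (cases "det (A \<omega>) = 0")
    case False
    then have "matrix_inv (A \<omega>) *v s \<omega> = (\<chi> k. D k (A \<omega>, s \<omega>) / det (A \<omega>))"
      using cramer[OF False] matrix_vector_mult_matrix_inv[OF False] by (simp add: D_def)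
    with False show ?thesis
      by (simp add: weighted_norm_sq_def inner_vec_def)
  qed (simp add: weighted_norm_sq_def matrix_inv_singular)
  then show ?thesis
    by simp
qed

theorem theorem3p1:
  fixes M :: "'a measure" and F :: "nat \<Rightarrow> 'a measure"
    and S :: "nat \<Rightarrow> 'a \<Rightarrow> real ^ 'n" and V :: "nat \<Rightarrow> 'a \<Rightarrow> real ^ 'n ^ 'n"
    and U0 :: "real ^ 'n ^ 'n" and \<delta> :: real
  assumes "filtered_prob_space M F"
    and "sub_gaussian_process M F S V"
    and "pos_def U0"
    and "0 < \<delta>" and "\<delta> < 1"
  shows "measure M {\<omega> \<in> space M.
      \<forall>\<tau>. stopping_time F \<tau> \<and> (\<forall>\<omega>'\<in>space M. 1 \<le> \<tau> \<omega>') \<longrightarrow>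
        weighted_norm_sq (matrix_inv (V (\<tau> \<omega>) \<omega> + U0)) (S (\<tau> \<omega>) \<omega>)
          \<le> ln (det (V (\<tau> \<omega>) \<omega> + U0) / det U0) + 2 * ln (1 / \<delta>)}
    \<ge> 1 - \<delta>"
proof -
  interpret filtered_prob_space M F by fact
  have sub: "adapted F S" "adapted F V" "\<And>t. AE \<omega> in M. pos_def (V t \<omega>)"
    using assms(2) by (auto simp: sub_gaussian_process_def sub_psi_process_def)
  have subG: "\<forall>\<theta>\<in>sphere (0::real^'n) 1. \<forall>l::real. 0 \<le> l \<and> ereal l < \<infinity> \<longrightarrow>
      (\<exists>L. supermartingale M F L \<and> (\<forall>t. AE \<omega> in M. 0 \<le> L t \<omega>) \<and> (AE \<omega> in M. L 0 \<omega> \<le> 1) \<and>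
        (\<forall>t. AE \<omega> in M. exp (l * (\<theta> \<bullet> S t \<omega>) - l\<^sup>2 / 2 * (\<theta> \<bullet> (V t \<omega> *v \<theta>))) \<le> L t \<omega>))"
    using assms(2) unfolding sub_gaussian_process_def sub_psi_process_def by blast
  have SF[measurable]: "S t \<in> borel_measurable (F t)" and VF[measurable]: "V t \<in> borel_measurable (F t)" for t
    using sub by (simp_all add: adapted_def)
  have [measurable]: "S t \<in> borel_measurable M" "V t \<in> borel_measurable M" for t
    by (rule measurable_from_subalg[OF subalgebra_F], measurable)+
  define bound where "bound t \<omega> \<longleftrightarrow> weighted_norm_sq (matrix_inv (V t \<omega> + U0)) (S t \<omega>)
    \<le> ln (det (V t \<omega> + U0) / det U0) + 2 * ln (1 / \<delta>)" for t \<omega>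
  define E where "E = {\<omega> \<in> space M. \<forall>t\<ge>1. bound t \<omega>}"
  have [measurable]: "(\<lambda>A. det A) \<in> borel_measurable (borel :: (real^'n^'n) measure)"
    by (intro borel_measurable_continuous_onI continuous_on_det continuous_intros)
  have E[measurable]: "E \<in> sets M"
    unfolding E_def bound_def by measurable

  define c where "c = (\<integral>\<^sup>+u. ennreal (exp (- ((u::real^'n) \<bullet> u) / 2)) \<partial>lborel)"
  have "0 < c" "c < \<infinity>"
    unfolding c_def by (rule nn_integral_standard_gaussian)+
  \<comment> \<open>The Gaussian weight is left unnormalised; its mass \<open>r\<close> satisfies
    \<open>c = sqrt (det U0) * r\<close>, by the Gaussian integral with
    \<open>s = 0\<close>.\<close>
  define N where "N = density lborel (\<lambda>u. ennreal (exp (- (u \<bullet> (U0 *v u) / 2))))"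
  have cont_quad: "continuous_on UNIV (\<lambda>u. exp (- (u \<bullet> (U0 *v u) / 2)))"
    by (auto intro!: continuous_intros matrix_vector_mult_linear_continuous_on)
  then have [measurable]: "(\<lambda>u. exp (- (u \<bullet> (U0 *v u) / 2))) \<in> borel_measurable borel"
    by (rule borel_measurable_continuous_onI)
  have detU: "det U0 > 0"
    using pos_def_det_pos assms(3) by blast
  have N_space: "ennreal (sqrt (det U0)) * emeasure N (space N) = c"
    using nn_integral_gaussian[OF assms(3), of 0]
    unfolding N_def by (subst emeasure_density) (simp_all add: c_def weighted_norm_sq_def)
  obtain r where r: "emeasure N (space N) = ennreal r" "r > 0"
  proof (cases "emeasure N (space N)")
    case (real r)
    with N_space \<open>0 < c\<close> show ?thesis
      by (intro that[of r]) (auto simp: less_le)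
  next
    case top
    with N_space \<open>c < \<infinity>\<close> detU show ?thesis
      by (simp add: ennreal_mult_top)
  qed
  interpret N: finite_measure N
    by standard (simp add: r)
  define Y where "Y t u \<omega> = exp (u \<bullet> S t \<omega> - u \<bullet> (V t \<omega> *v u) / 2)" for t u \<omega>
  have Y_meas: "(\<lambda>(u, \<omega>). Y t u \<omega>) \<in> borel_measurable (N \<Otimes>\<^sub>M F t)" for t
  proof -
    have [measurable_cong]: "sets N = sets borel"
      by (simp add: N_def)
    \<comment> \<open>In coordinates the exponent is a polynomial, which makes joint measurability
      automatic.\<close>
    have "(\<lambda>(u, \<omega>). exp ((\<Sum>i\<in>UNIV. u $ i * S t \<omega> $ i)
        - (\<Sum>i\<in>UNIV. u $ i * (\<Sum>j\<in>UNIV. V t \<omega> $ i $ j * u $ j)) / 2)) \<in> borel_measurable (N \<Otimes>\<^sub>M F t)"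
      by measurable
    then show ?thesis
      by (simp add: Y_def inner_vec_def matrix_vector_mult_def)
  qed
  have dom: "\<exists>L. supermartingale M F L \<and> (\<forall>t. AE \<omega> in M. 0 \<le> L t \<omega>) \<and>
      (AE \<omega> in M. L 0 \<omega> \<le> 1) \<and> (\<forall>t. AE \<omega> in M. Y t u \<omega> \<le> L t \<omega>)" for u
  proof -
    \<comment> \<open>Polar form of \<open>u\<close>. For \<open>u = 0\<close> any unit vector will
      do, since the value 0 is allowed for the scalar parameter.\<close>
    obtain \<theta> where \<theta>: "\<theta> \<in> sphere (0::real^'n) 1" "u = norm u *\<^sub>R \<theta>"
    proof (cases "u = 0")
      case True
      then show ?thesis
        using that[of "axis undefined 1"] by simp
    next
      case False
      then show ?thesis
        using that[of "u /\<^sub>R norm u"] by simp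
    qed
    obtain L where L: "supermartingale M F L" "\<forall>t. AE \<omega> in M. 0 \<le> L t \<omega>" "AE \<omega> in M. L 0 \<omega> \<le> 1"
      "\<forall>t. AE \<omega> in M. exp (norm u * (\<theta> \<bullet> S t \<omega>) - (norm u)\<^sup>2 / 2 * (\<theta> \<bullet> (V t \<omega> *v \<theta>))) \<le> L t \<omega>"
      using bspec[OF subG \<theta>(1), rule_format, of "norm u"] by auto
    have "norm u * (\<theta> \<bullet> S t \<omega>) = u \<bullet> S t \<omega>" for t \<omega>
      by (subst (2) \<theta>(2)) simp
    moreover have "(norm u)\<^sup>2 * (\<theta> \<bullet> (V t \<omega> *v \<theta>)) = u \<bullet> (V t \<omega> *v u)" for t \<omega>
      by (subst (2 3) \<theta>(2)) (simp add: matrix_vector_mult_scaleR power2_eq_square)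
    ultimately show ?thesis
      using L by (auto simp: Y_def)
  qed

  \<comment> \<open>The level is the mass \<open>r\<close> of \<open>N\<close> divided by
    \<open>\<delta>\<close>, so the maximal inequality bounds the probability of \<open>H\<close> by
    \<open>\<delta>\<close>. \<open>H\<close> includes time 0, which only enlarges it.\<close>
  define H where "H = {\<omega> \<in> space M. \<exists>t. ennreal (r / \<delta>) \<le> (\<integral>\<^sup>+u. ennreal (Y t u \<omega>) \<partial>N)}"
  note maximal = mixture_maximal_inequality[OF assms(1) N.sigma_finite_measure_axioms Y_meas dom,
      where K = "ennreal (r / \<delta>)", folded H_def]
  have "ennreal (r / \<delta>) * ennreal (measure M H) \<le> ennreal r"
    using maximal(2) r by (simp add: emeasure_eq_measure)
  then have "r / \<delta> * measure M H \<le> r"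
    using assms(4) r by (subst (asm) ennreal_mult[symmetric]) auto
  then have H_le: "measure M H \<le> \<delta>"
    using r assms(4) by (simp add: field_simps)

  \<comment> \<open>The mixture equals \<open>r\<close> times the square root of
    \<open>det U0 / det ?A\<close> times the exponential of half the weighted norm. Failure of the
    bound, halved and exponentiated, puts this above \<open>r / \<delta>\<close>.\<close>
  have exceed: "ennreal (r / \<delta>) \<le> (\<integral>\<^sup>+u. ennreal (Y t u \<omega>) \<partial>N)" if V: "pos_def (V t \<omega>)" and "\<not> bound t \<omega>" for t \<omega>
  proof -
    let ?A = "V t \<omega> + U0"
    have A: "pos_def ?A"
      using V assms(3) by (rule pos_def_add)
    have detA: "det ?A > 0"
      using A by (rule pos_def_det_pos)
    have "(\<integral>\<^sup>+u. ennreal (Y t u \<omega>) \<partial>N) = (\<integral>\<^sup>+u. ennreal (exp (u \<bullet> S t \<omega> - u \<bullet> (?A *v u) / 2)) \<partial>lborel)"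
    proof -
      have [measurable]: "(\<lambda>u. Y t u \<omega>) \<in> borel_measurable borel"
        unfolding Y_def by (auto intro!: borel_measurable_continuous_onI continuous_intros
            matrix_vector_mult_linear_continuous_on)
      \<comment> \<open>The quadratic forms of \<open>U0\<close> and \<open>V t \<omega>\<close> add
        up, so the integrand is again Gaussian, with matrix \<open>?A\<close>.\<close>
      have "ennreal (exp (- (u \<bullet> (U0 *v u) / 2))) * ennreal (Y t u \<omega>)
          = ennreal (exp (u \<bullet> S t \<omega> - u \<bullet> (?A *v u) / 2))" for u
        by (simp add: Y_def matrix_vector_mult_add_rdistrib inner_add_right add_divide_distrib
            flip: ennreal_mult exp_add)
      then show ?thesis
        unfolding N_def by (subst nn_integral_density) simp_all
    qed
    then have Z: "ennreal (sqrt (det ?A)) * (\<integral>\<^sup>+u. ennreal (Y t u \<omega>) \<partial>N)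
        = ennreal (exp (weighted_norm_sq (matrix_inv ?A) (S t \<omega>) / 2)) * c"
      using nn_integral_gaussian[OF A] by (simp add: c_def)
    have "ln (det ?A / det U0) + 2 * ln (1 / \<delta>) \<le> weighted_norm_sq (matrix_inv ?A) (S t \<omega>)"
      using \<open>\<not> bound t \<omega>\<close> by (simp add: bound_def)
    then have "exp (ln (det ?A / det U0) / 2 + ln (1 / \<delta>)) \<le> exp (weighted_norm_sq (matrix_inv ?A) (S t \<omega>) / 2)"
      by simp
    moreover have "exp (ln (det ?A / det U0) / 2 + ln (1 / \<delta>)) = sqrt (det ?A) / sqrt (det U0) / \<delta>"
      using detA detU assms(4) by (simp add: exp_add ln_sqrt[symmetric] real_sqrt_divide)
    ultimately have "sqrt (det ?A) / sqrt (det U0) / \<delta> \<le> exp (weighted_norm_sq (matrix_inv ?A) (S t \<omega>) / 2)"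
      by (simp only:)
    \<comment> \<open>The multiplier \<open>sqrt (det U0) * r\<close> is \<open>c\<close>; it clears
      the denominator and matches the right side of \<open>Z\<close>.\<close>
    then have "sqrt (det ?A) / sqrt (det U0) / \<delta> * (sqrt (det U0) * r)
        \<le> exp (weighted_norm_sq (matrix_inv ?A) (S t \<omega>) / 2) * (sqrt (det U0) * r)"
      using detU r by (intro mult_right_mono) simp_all
    moreover have "sqrt (det ?A) / sqrt (det U0) / \<delta> * (sqrt (det U0) * r) = sqrt (det ?A) * (r / \<delta>)"
      using detU by simp
    ultimately have "sqrt (det ?A) * (r / \<delta>)
        \<le> exp (weighted_norm_sq (matrix_inv ?A) (S t \<omega>) / 2) * (sqrt (det U0) * r)"
      by simp
    then have "ennreal (sqrt (det ?A)) * ennreal (r / \<delta>)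
        \<le> ennreal (exp (weighted_norm_sq (matrix_inv ?A) (S t \<omega>) / 2)) * c"
      using detA detU assms(4) r by (simp add: N_space[symmetric] ennreal_leI flip: ennreal_mult)
    then show ?thesis
      using detA by (simp add: Z[symmetric] ennreal_mult_le_mult_iff)
  qed
  \<comment> \<open>Time is countable, so positive definiteness holds at all times off one null set;
    there, leaving \<open>E\<close> forces membership in \<open>H\<close>.\<close>
  have "AE \<omega> in M. \<forall>t. pos_def (V t \<omega>)"
    using sub(3) by (simp add: AE_all_countable)
  then have "AE \<omega> in M. \<omega> \<in> space M - E \<longrightarrow> \<omega> \<in> H"
    by eventually_elim (unfold E_def H_def, blast intro: exceed)
  then have "measure M (space M - E) \<le> measure M H"
    by (rule finite_measure_mono_AE) (rule maximal(1))
  then have "1 - \<delta> \<le> measure M E"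
    using H_le by (simp add: prob_compl)
  also have "E = {\<omega> \<in> space M. \<forall>\<tau>. stopping_time F \<tau> \<and> (\<forall>\<omega>'\<in>space M. 1 \<le> \<tau> \<omega>') \<longrightarrow> bound (\<tau> \<omega>) \<omega>}"
    using all_stopping_times_iff_all_times[of _ "space M" F bound] by (auto simp: E_def)
  finally show ?thesis
    by (simp add: bound_def)
qed

end
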